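(* Let $T$ be the random recursive tree in which each new vertex is connected to the last vertex with probability $p$ or to the second-last vertex with probability $q=1-p$. Then $T$ has the infinite collision property.
   Context: Random recursive tree. Start with the graph $T_1=(V_1,E_1)$, where $V_1=\{v_0,v_1\}$ and $E_1=\{\langle v_0,v_1\rangle\}$. At step $n\ge 1$, given $T_n=(V_n,E_n)$ with $V_n=\{v_0,\dots,v_n\}$, put $V_{n+1}=V_n\cup\{v_{n+1}\}$ and $E_{n+1}=E_n\cup\{\langle v_{n+1},w_n\rangle\}$, where the $w_n$ are independent random variables with $\mathbb{P}(w_n=v_n)=p$ and $\mathbb{P}(w_n=v_{n-1})=q=1-p$. The random recursive tree is $T=\bigcup_{n\ge1}T_n$. Infinite collision property. Let $G$ be an infinite connected graph, and let $X=\{X_n\}$ and $X'=\{X'_n\}$ be two independent simple random walks on $G$. The graph $G$ has the infinite collision property if $|\{n: X_n=X'_n\}|=\infty$ almost surely (that is, the two walks occupy the same vertex at the same time infinitely often). *)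

theory Defs
  imports "HOL-Probability.Probability"
begin

section \<open>Graphs\<close>

text \<open>A graph is given by a vertex set \<open>V\<close> and a set \<open>E\<close> of unordered edges.\<close>

definition simple_graph :: "'a set \<Rightarrow> 'a set set \<Rightarrow> bool" where
  "simple_graph V E \<longleftrightarrow> (\<forall>e\<in>E. e \<subseteq> V \<and> card e = 2)"

definition neighbours :: "'a set set \<Rightarrow> 'a \<Rightarrow> 'a set" where
  "neighbours E x = {y. {x, y} \<in> E}"

definition connected_graph :: "'a set \<Rightarrow> 'a set set \<Rightarrow> bool" where
  "connected_graph V E \<longleftrightarrow> (\<forall>u\<in>V. \<forall>v\<in>V. (u, v) \<in> {(x, y). {x, y} \<in> E}\<^sup>*)"

definition locally_finite_graph :: "'a set \<Rightarrow> 'a set set \<Rightarrow> bool" where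
  "locally_finite_graph V E \<longleftrightarrow> (\<forall>v\<in>V. finite (neighbours E v))"


section \<open>Simple random walk\<close>

text \<open>
  The kernel at time \<open>i\<close> depends on the history \<open>x 0, \<dots>, x (i - 1)\<close>.  Note that
  \<^const>\<open>pmf_of_set\<close> is the uniform distribution only on finite nonempty sets, so the walk
  is meaningful only on locally finite graphs without isolated vertices.
\<close>

definition srw_kernel :: "'a set set \<Rightarrow> 'a \<Rightarrow> nat \<Rightarrow> (nat \<Rightarrow> 'a) \<Rightarrow> 'a measure" where
  "srw_kernel E v i x =
     measure_pmf (if i = 0 then return_pmf v else pmf_of_set (neighbours E (x (i - 1))))"

lemma Ionescu_Tulcea_srw: "Ionescu_Tulcea (srw_kernel E v) (\<lambda>_. count_space UNIV)"
proof (rule Ionescu_Tulcea.intro)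
  fix i :: nat
  show "srw_kernel E v i \<in> measurable (PiM {0..<i} (\<lambda>_. count_space UNIV))
          (subprob_algebra (count_space UNIV))"
  proof (cases i)
    case 0
    then show ?thesis
      by (auto simp: srw_kernel_def[abs_def] space_subprob_algebra measure_pmf.subprob_space_axioms
               intro!: measurable_const)
  next
    case (Suc j)
    have "(\<lambda>y. measure_pmf (pmf_of_set (neighbours E y)))
            \<in> measurable (count_space UNIV) (subprob_algebra (count_space UNIV))"
      by (auto simp: space_subprob_algebra measure_pmf.subprob_space_axioms)
    moreover have "(\<lambda>x. x j) \<in> measurable (PiM {0..<i} (\<lambda>_. count_space UNIV)) (count_space UNIV)"
      using Suc by (intro measurable_component_singleton) auto
    ultimately show ?thesis
      unfolding srw_kernel_def[abs_def] using Suc by (auto intro: measurable_compose)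
  qed
qed (simp only: srw_kernel_def measure_pmf.prob_space_axioms)

interpretation srw: Ionescu_Tulcea "srw_kernel E v" "\<lambda>_. count_space UNIV" for E v
  by (rule Ionescu_Tulcea_srw)

text \<open>The law on path space of the simple random walk started at \<open>v\<close>.\<close>

definition srw :: "'a set set \<Rightarrow> 'a \<Rightarrow> (nat \<Rightarrow> 'a) measure" where
  "srw E v = srw.PF.lim E v"

lemma sets_srw: "sets (srw E v) = sets (PiM UNIV (\<lambda>_. count_space UNIV))"
  by (simp add: srw_def)

lemma prob_space_srw: "prob_space (srw E v)"
  unfolding srw_def
proof (rule prob_space_distrD)
  let ?M = "\<lambda>_::nat. count_space UNIV"
  show "(\<lambda>x. restrict x {}) \<in> measurable (srw.PF.lim E v) (PiM {} ?M)"
    by (auto simp: measurable_cong_sets[OF srw.PF.sets_lim] intro!: measurable_restrict_subset)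
  show "prob_space (distr (srw.PF.lim E v) (PiM {} ?M) (\<lambda>x. restrict x {}))"
    by (subst srw.distr_lim) (auto intro: srw.PF.prob_space_P)
qed

lemma emeasure_srw_path:
  "emeasure (srw E v) {x. \<forall>i\<le>n. x i = y i} =
     ennreal (indicator {v} (y 0) * (\<Prod>i<n. pmf (pmf_of_set (neighbours E (y i))) (y (Suc i))))"
proof -
  let ?M = "\<lambda>_::nat. count_space (UNIV :: 'a set)"
  define A where "A m = (\<Pi>\<^sub>E i\<in>{0..<m}. {y i})" for m
  have A_sets [measurable]: "A m \<in> sets (PiM {0..<m} ?M)" for m
    unfolding A_def by (rule sets_PiM_I_finite) auto
  have A_eq: "A m = {restrict y {0..<m}}" for m
    unfolding A_def by (auto simp: PiE_iff extensional_def restrict_def fun_eq_iff)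
  define K where "K m = (if m = 0 then return_pmf v else pmf_of_set (neighbours E (y (m - 1))))" for m
  have C: "emeasure (srw.C E v 0 m (\<lambda>_. undefined)) (A m) = (\<Prod>i<m. ennreal (pmf (K i) (y i)))" for m
  proof (induction m)
    case 0
    then show ?case by (simp add: A_def emeasure_return PiM_empty)
  next
    case (Suc m)
    have sets_C: "sets (srw.C E v 0 m (\<lambda>_. undefined)) = sets (PiM {0..<m} ?M)"
      using srw.sets_C[of "\<lambda>_. undefined" 0 E v m] by (simp add: space_PiM)
    have eP: "srw.eP E v m \<in> measurable (srw.C E v 0 m (\<lambda>_. undefined))
        (subprob_algebra (PiM {0..<Suc m} ?M))"
      unfolding measurable_cong_sets[OF sets_C refl] by (rule srw.measurable_eP)
    have "space (srw.C E v 0 m (\<lambda>_. undefined)) \<noteq> {}"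
      unfolding sets_eq_imp_space_eq[OF sets_C] by (auto simp: space_PiM PiE_eq_empty_iff)
    then have "emeasure (srw.C E v 0 (Suc m) (\<lambda>_. undefined)) (A (Suc m)) =
        (\<integral>\<^sup>+ x. emeasure (srw.eP E v m x) (A (Suc m)) \<partial>srw.C E v 0 m (\<lambda>_. undefined))"
      using emeasure_bind[OF _ eP A_sets] by simp
    also have "\<dots> = (\<integral>\<^sup>+ x. ennreal (pmf (K m) (y m)) * indicator (A m) x \<partial>srw.C E v 0 m (\<lambda>_. undefined))"
    proof (rule nn_integral_cong)
      fix x assume "x \<in> space (srw.C E v 0 m (\<lambda>_. undefined))"
      then have x: "x \<in> space (PiM {0..<m} ?M)"
        by (subst (asm) srw.space_C) auto
      then have ext: "x \<in> extensional {0..<m}" by (auto simp: space_PiM PiE_def)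
      have upd: "fun_upd x m z \<in> A (Suc m) \<longleftrightarrow> x \<in> A m \<and> z = y m" for z
        using ext unfolding A_def
        by (auto simp: PiE_iff extensional_def atLeastLessThanSuc split: if_splits)
      have "emeasure (srw.eP E v m x) (A (Suc m)) = emeasure (srw_kernel E v m x) {z. x \<in> A m \<and> z = y m}"
        by (subst srw.emeasure_eP[OF x A_sets]) (auto simp: upd intro!: arg_cong[where f = "emeasure _"])
      also have "\<dots> = ennreal (pmf (K m) (y m)) * indicator (A m) x"
      proof (cases "x \<in> A m")
        case True
        then have "m > 0 \<Longrightarrow> x (m - 1) = y (m - 1)" by (auto simp: A_eq)
        with True show ?thesis
          by (auto simp: srw_kernel_def K_def emeasure_pmf_single)
      qed auto
      finally show "emeasure (srw.eP E v m x) (A (Suc m)) = ennreal (pmf (K m) (y m)) * indicator (A m) x" .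
    qed
    also have "\<dots> = ennreal (pmf (K m) (y m)) * emeasure (srw.C E v 0 m (\<lambda>_. undefined)) (A m)"
      by (rule nn_integral_cmult_indicator) (subst srw.sets_C, auto)
    finally show ?case using Suc.IH by (simp add: mult.commute)
  qed
  have "{x. \<forall>i\<le>n. x i = y i} = prod_emb UNIV ?M {0..<Suc n} (A (Suc n))"
    unfolding prod_emb_def A_def by (auto simp: space_PiM PiE_iff less_Suc_eq_le)
  then have "emeasure (srw E v) {x. \<forall>i\<le>n. x i = y i} = emeasure (srw.CI E v {0..<Suc n}) (A (Suc n))"
    unfolding srw_def by (simp only:) (rule srw.lim, auto)
  also have "\<dots> = emeasure (srw.C E v 0 (Suc n) (\<lambda>_. undefined)) (A (Suc n))"
    by (subst srw.emeasure_CI[of _ "Suc n"]) 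
       (auto simp del: srw.C.simps intro!: arg_cong[where f = "emeasure _"] simp: prod_emb_id A_def space_PiM)
  also have "\<dots> = (\<Prod>i<Suc n. ennreal (pmf (K i) (y i)))"
    by (rule C)
  also have "\<dots> = ennreal (\<Prod>i<Suc n. pmf (K i) (y i))"
    by (rule prod_ennreal) auto
  also have "(\<Prod>i<Suc n. pmf (K i) (y i)) =
      indicator {v} (y 0) * (\<Prod>i<n. pmf (pmf_of_set (neighbours E (y i))) (y (Suc i)))"
    by (subst prod.lessThan_Suc_shift) (auto simp: K_def indicator_def)
  finally show ?thesis .
qed


section \<open>The infinite collision property\<close>

text \<open>
  Both walks start at the same, arbitrary vertex: on a bipartite graph, such as a tree, walks
  started at odd distance never meet.
\<close>

definition infinite_collision_property :: "'a set \<Rightarrow> 'a set set \<Rightarrow> bool" where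
  "infinite_collision_property V E \<longleftrightarrow>
     simple_graph V E \<and> infinite V \<and> connected_graph V E \<and> locally_finite_graph V E \<and>
     (\<forall>v\<in>V. AE (x, x') in srw E v \<Otimes>\<^sub>M srw E v. infinite {n. x n = x' n})"


section \<open>The recursive tree\<close>

text \<open>
  The vertex \<open>v\<^sub>k\<close> is the number \<open>k\<close>, and \<open>w n\<close> is the vertex to which \<open>n + 1\<close> gets attached.
  The value at index \<open>0\<close> is a dummy, since the construction starts with \<open>T\<^sub>1\<close>.
\<close>

definition step_vertices :: "nat \<Rightarrow> nat set" where
  "step_vertices n = {0..n}"

fun step_edges :: "(nat \<Rightarrow> nat) \<Rightarrow> nat \<Rightarrow> nat set set" where
  "step_edges w 0 = {}"
| "step_edges w (Suc 0) = {{0, 1}}"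
| "step_edges w (Suc (Suc n)) = insert {Suc (Suc n), w (Suc n)} (step_edges w (Suc n))"

definition tree_vertices :: "nat set" where
  "tree_vertices = (\<Union>n\<in>{1..}. step_vertices n)"

definition tree_edges :: "(nat \<Rightarrow> nat) \<Rightarrow> nat set set" where
  "tree_edges w = (\<Union>n\<in>{1..}. step_edges w n)"

end

theory Submission
  imports Defs
begin

text \<open>
  The tree has the infinite collision property for every choice of attachments
  \<open>w n \<in> {n, n - 1}\<close>, so randomness enters only through the fact that almost surely all attachments
  are of this form.

  Let \<open>G(x, y)\<close> be the Green function, divided by the degree, of one walk killed at the vertices
  \<open>N\<close> and \<open>N + 1\<close>, which separate \<open>{0, \<dots>, N - 1}\<close> from the rest of the tree. On a tree it is
  an explicit expression in graph distances. As a function of both walks it is harmonic for the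
  product walk on off-diagonal pairs at even distance, and it vanishes as soon as one walk is
  killed. By the maximum principle two walks at \<open>x\<close> and \<open>y\<close> meet with probability at least
  \<open>G(x, y) / max G(z, z)\<close>. Depth is monotone along the construction, hence \<open>G(z, z)\<close> is at most
  twice the depth of \<open>N\<close>, while \<open>G(x, y)\<close> is at least half of it up to a constant depending on
  \<open>x\<close> and \<open>y\<close>. So walks at even distance meet with probability at least \<open>1 / 5\<close>. A uniform lower
  bound improves itself to \<open>1\<close> by the Markov property, and the walks meet after any given time.
\<close>

section \<open>Markov property\<close>

definition depends_upto :: "nat \<Rightarrow> ((nat \<Rightarrow> 'a) \<Rightarrow> 'b) \<Rightarrow> bool" where
  "depends_upto n f \<longleftrightarrow> (\<forall>x y. (\<forall>i\<le>n. x i = y i) \<longrightarrow> f x = f y)"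

lemma depends_uptoD: "depends_upto n f \<Longrightarrow> (\<And>i. i \<le> n \<Longrightarrow> x i = y i) \<Longrightarrow> f x = f y"
  unfolding depends_upto_def by blast

text \<open>Points of \<open>PiM {0..<m}\<close> are total functions equal to
  \<open>undefined\<close> from \<open>m\<close> on, so they embed measurably in path space. A
  functional of whole paths can thus be integrated directly against finite-time laws.\<close>

lemma measurable_count_space_prefix:
  fixes G :: "(nat \<Rightarrow> 'a) \<Rightarrow> ennreal"
  assumes G: "G \<in> borel_measurable (PiM UNIV (\<lambda>_. count_space UNIV))"
  shows "G \<in> borel_measurable (PiM {0..<m::nat} (\<lambda>_. count_space UNIV))"
proof -
  have "(\<lambda>x. x) \<in> measurable (PiM {0..<m} (\<lambda>_. count_space (UNIV :: 'a set)))
      (PiM UNIV (\<lambda>_. count_space UNIV))"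
  proof (rule measurable_PiM_single')
    fix i :: nat
    show "(\<lambda>x. x i) \<in> measurable (PiM {0..<m} (\<lambda>_. count_space (UNIV :: 'a set))) (count_space UNIV)"
    proof (cases "i < m")
      case True
      then show ?thesis by (intro measurable_component_singleton) auto
    next
      case False
      have "(\<lambda>x. undefined) \<in> measurable (PiM {0..<m} (\<lambda>_. count_space (UNIV :: 'a set))) (count_space UNIV)"
        by simp
      then show ?thesis
        by (rule measurable_cong[THEN iffD1, rotated])
           (use False in \<open>auto simp: space_PiM PiE_def extensional_def\<close>)
    qed
  qed (auto simp: space_PiM)
  from measurable_compose[OF this G] show ?thesis by simp
qed

text \<open>The law of coordinates \<open>0\<close> to \<open>n\<close> is the kernel composition
  \<open>srw.C\<close>, and \<open>G\<close> does not notice the restriction to them.\<close>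

lemma nn_integral_srw_prefix:
  assumes G: "G \<in> borel_measurable (PiM UNIV (\<lambda>_. count_space UNIV))"
    and dep: "depends_upto n G"
  shows "(\<integral>\<^sup>+x. G x \<partial>srw E v) = (\<integral>\<^sup>+x. G x \<partial>srw.C E v 0 (Suc n) (\<lambda>_. undefined))"
proof -
  let ?M = "\<lambda>_::nat. count_space (UNIV :: 'a set)"
  let ?J = "{0..<Suc n}"
  let ?C = "srw.C E v 0 (Suc n) (\<lambda>_. undefined)"
  have sets_C: "sets ?C = sets (PiM ?J ?M)"
    using srw.sets_C[of "\<lambda>_. undefined" 0 E v "Suc n"] by (simp add: space_PiM)
  have "distr (srw E v) (PiM ?J ?M) (\<lambda>x. restrict x ?J) = ?C"
  proof (rule measure_eqI)
    fix A assume "A \<in> sets (distr (srw E v) (PiM ?J ?M) (\<lambda>x. restrict x ?J))"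
    then have A: "A \<in> sets (PiM ?J ?M)" by simp
    have "emeasure (distr (srw E v) (PiM ?J ?M) (\<lambda>x. restrict x ?J)) A = emeasure (srw.CI E v ?J) A"
      unfolding srw_def by (subst srw.distr_lim) auto
    also have "\<dots> = emeasure ?C (prod_emb ?J ?M ?J A)"
      by (rule srw.emeasure_CI) (use A in auto)
    also have "prod_emb ?J ?M ?J A = A"
      by (rule prod_emb_id) (use sets.sets_into_space[OF A] in \<open>auto simp: space_PiM\<close>)
    finally show "emeasure (distr (srw E v) (PiM ?J ?M) (\<lambda>x. restrict x ?J)) A = emeasure ?C A" .
  qed (use sets_C in simp)
  moreover have "(\<integral>\<^sup>+x. G x \<partial>distr (srw E v) (PiM ?J ?M) (\<lambda>x. restrict x ?J)) =
      (\<integral>\<^sup>+x. G (restrict x ?J) \<partial>srw E v)"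
    by (rule nn_integral_distr)
       (auto simp: measurable_cong_sets[OF sets_srw refl]
             intro!: measurable_restrict measurable_component_singleton measurable_count_space_prefix G)
  moreover have "G (restrict x ?J) = G x" for x
    by (rule depends_uptoD[OF dep]) auto
  ultimately show ?thesis by simp
qed

text \<open>Markov property at time \<open>n\<close> in integrated form, with \<open>G\<close> as
  test function of the past. The last kernel is integrated first; overwriting coordinate
  \<open>Suc n\<close> leaves \<open>G\<close> fixed.\<close>

lemma nn_integral_srw_Suc:
  fixes f :: "'a \<Rightarrow> ennreal"
  assumes G: "G \<in> borel_measurable (PiM UNIV (\<lambda>_. count_space UNIV))"
    and dep: "depends_upto n G"
  shows "(\<integral>\<^sup>+x. G x * f (x (Suc n)) \<partial>srw E v) =
    (\<integral>\<^sup>+x. G x * (\<integral>\<^sup>+z. f z \<partial>measure_pmf (pmf_of_set (neighbours E (x n)))) \<partial>srw E v)"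
proof -
  let ?M = "\<lambda>_::nat. count_space (UNIV :: 'a set)"
  let ?C = "\<lambda>n. srw.C E v 0 n (\<lambda>_. undefined)"
  have sets_C: "sets (?C n) = sets (PiM {0..<n} ?M)" for n
    using srw.sets_C[of "\<lambda>_. undefined" 0 E v n] by (simp add: space_PiM)
  have comp: "(\<lambda>x. g (x i)) \<in> borel_measurable (PiM UNIV ?M)" for g :: "'a \<Rightarrow> ennreal" and i
    by (rule measurable_compose[OF measurable_component_singleton]) auto
  define H where "H x = G x * f (x (Suc n))" for x
  have H: "H \<in> borel_measurable (PiM UNIV ?M)"
    unfolding H_def by (intro borel_measurable_times_ennreal G comp)
  have depH: "depends_upto (Suc n) H"
    unfolding depends_upto_def H_def
    by (intro allI impI arg_cong2[where f="(*)"] depends_uptoD[OF dep]) auto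
  \<comment> \<open>Prolonging the composition by one coordinate is by definition a bind with the
    one-step extension \<open>srw.eP\<close>.\<close>
  have "(\<integral>\<^sup>+x. H x \<partial>srw E v) = (\<integral>\<^sup>+x. H x \<partial>(?C (Suc n) \<bind> srw.eP E v (Suc n)))"
    by (subst nn_integral_srw_prefix[OF H depH]) simp
  also have "\<dots> = (\<integral>\<^sup>+x. \<integral>\<^sup>+y. H y \<partial>srw.eP E v (Suc n) x \<partial>?C (Suc n))"
    by (rule nn_integral_bind[where B = "PiM {0..<Suc (Suc n)} ?M"])
       (simp_all add: measurable_count_space_prefix H measurable_cong_sets[OF sets_C refl] srw.measurable_eP del: srw.C.simps)
  also have "\<dots> = (\<integral>\<^sup>+x. G x * (\<integral>\<^sup>+z. f z \<partial>measure_pmf (pmf_of_set (neighbours E (x n)))) \<partial>?C (Suc n))"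
  proof (rule nn_integral_cong)
    fix x assume "x \<in> space (?C (Suc n))"
    then have x: "x \<in> space (PiM {0..<Suc n} ?M)"
      by (simp only: sets_eq_imp_space_eq[OF sets_C])
    have "(\<integral>\<^sup>+y. H y \<partial>srw.eP E v (Suc n) x) = (\<integral>\<^sup>+z. H (fun_upd x (Suc n) z) \<partial>srw_kernel E v (Suc n) x)"
      by (rule srw.nn_integral_eP[OF x measurable_count_space_prefix[OF H]])
    also have "\<dots> = (\<integral>\<^sup>+z. G x * f z \<partial>srw_kernel E v (Suc n) x)"
      unfolding H_def
      by (intro nn_integral_cong arg_cong2[where f="(*)"] depends_uptoD[OF dep]) auto
    also have "\<dots> = G x * (\<integral>\<^sup>+z. f z \<partial>measure_pmf (pmf_of_set (neighbours E (x n))))"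
      by (simp add: srw_kernel_def nn_integral_cmult)
    finally show "(\<integral>\<^sup>+y. H y \<partial>srw.eP E v (Suc n) x) = \<dots>" .
  qed
  also have "\<dots> = (\<integral>\<^sup>+x. G x * (\<integral>\<^sup>+z. f z \<partial>measure_pmf (pmf_of_set (neighbours E (x n)))) \<partial>srw E v)"
    by (rule nn_integral_srw_prefix[symmetric])
       (auto intro!: borel_measurable_times_ennreal G comp arg_cong2[where f="(*)"]
          depends_uptoD[OF dep] simp: depends_upto_def)
  finally show ?thesis by (simp add: H_def)
qed

section \<open>Meetings of two independent walks\<close>

text \<open>Transition operator of the product walk, for finite nonempty neighbourhoods.\<close>

definition avg2 :: "'a set set \<Rightarrow> ('a \<Rightarrow> 'a \<Rightarrow> real) \<Rightarrow> 'a \<Rightarrow> 'a \<Rightarrow> real" where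
  "avg2 E f x y = (\<Sum>x'\<in>neighbours E x. \<Sum>y'\<in>neighbours E y. f x' y') /
     (real (card (neighbours E x)) * real (card (neighbours E y)))"

text \<open>Probability that walks from \<open>x\<close> and \<open>y\<close> differ at all of the
  \<open>n\<close> times \<open>0\<close> to \<open>n - 1\<close>; index \<open>0\<close> imposes
  nothing.\<close>

primrec no_meet :: "'a set set \<Rightarrow> nat \<Rightarrow> 'a \<Rightarrow> 'a \<Rightarrow> real" where
  "no_meet E 0 = (\<lambda>x y. 1)"
| "no_meet E (Suc n) = (\<lambda>x y. if x = y then 0 else avg2 E (no_meet E n) x y)"

lemma avg2_nonneg: "(\<And>x y. 0 \<le> f x y) \<Longrightarrow> 0 \<le> avg2 E f x y"
  unfolding avg2_def by (intro divide_nonneg_nonneg sum_nonneg mult_nonneg_nonneg) auto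

lemma no_meet_nonneg: "0 \<le> no_meet E n x y"
  by (induction n arbitrary: x y) (auto intro!: avg2_nonneg)

lemma avg2_mono:
  assumes "\<And>x' y'. x' \<in> neighbours E x \<Longrightarrow> y' \<in> neighbours E y \<Longrightarrow> f x' y' \<le> g x' y'"
  shows "avg2 E f x y \<le> avg2 E g x y"
  unfolding avg2_def by (intro divide_right_mono sum_mono assms) auto

lemma avg2_cmult: "avg2 E (\<lambda>x y. c * f x y) x y = c * avg2 E f x y"
  unfolding avg2_def by (simp add: sum_distrib_left)

lemma avg2_diff: "avg2 E (\<lambda>x y. f x y - g x y) x y = avg2 E f x y - avg2 E g x y"
  unfolding avg2_def by (simp add: sum_subtractf diff_divide_distrib)

lemma tendsto_avg2:
  assumes "\<And>x' y'. x' \<in> neighbours E x \<Longrightarrow> y' \<in> neighbours E y \<Longrightarrow> (\<lambda>n. f n x' y') \<longlonglongrightarrow> g x' y'"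
  shows "(\<lambda>n. avg2 E (f n) x y) \<longlonglongrightarrow> avg2 E g x y"
  unfolding avg2_def divide_inverse by (intro tendsto_mult_right tendsto_sum assms)

text \<open>On a countable vertex type the product of two discrete sigma-algebras is discrete, so
  measurability in the two positions is automatic.\<close>

lemma measurable_pair_path:
  fixes f :: "'a::countable \<Rightarrow> 'a \<Rightarrow> 'c"
  assumes "\<And>x y. f x y \<in> space N"
  shows "(\<lambda>p. f (fst p i) (snd p j)) \<in>
    measurable (PiM UNIV (\<lambda>_::nat. count_space UNIV) \<Otimes>\<^sub>M PiM UNIV (\<lambda>_::nat. count_space UNIV)) N"
proof -
  have "(\<lambda>p. (fst p i, snd p j)) \<in>
    measurable (PiM UNIV (\<lambda>_::nat. count_space (UNIV::'a set)) \<Otimes>\<^sub>M PiM UNIV (\<lambda>_::nat. count_space (UNIV::'a set)))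
      (count_space UNIV \<Otimes>\<^sub>M count_space UNIV)"
    by (intro measurable_Pair measurable_compose[OF measurable_fst measurable_component_singleton]
        measurable_compose[OF measurable_snd measurable_component_singleton]) auto
  then have *: "(\<lambda>p. (fst p i, snd p j)) \<in>
    measurable (PiM UNIV (\<lambda>_::nat. count_space (UNIV::'a set)) \<Otimes>\<^sub>M PiM UNIV (\<lambda>_::nat. count_space (UNIV::'a set)))
      (count_space UNIV)"
    by (simp add: pair_measure_countable)
  have "(\<lambda>(x, y). f x y) \<in> measurable (count_space UNIV) N"
    using assms by auto
  from measurable_compose[OF * this] show ?thesis
    by simp
qed

section \<open>Probabilities of not meeting and their limit\<close>

locale srw_graph =
  fixes E :: "'a::countable set set"
  assumes finite_neighbours: "finite (neighbours E x)"
    and neighbours_nonempty: "neighbours E x \<noteq> {}"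
begin

abbreviation "paths \<equiv> PiM UNIV (\<lambda>_::nat. count_space (UNIV::'a set))"

lemma card_neighbours_pos: "0 < card (neighbours E x)"
  by (simp add: card_gt_0_iff finite_neighbours neighbours_nonempty)

lemma avg2_const: "avg2 E (\<lambda>x y. c) x y = c"
  using card_neighbours_pos[of x] card_neighbours_pos[of y] by (simp add: avg2_def)

lemma no_meet_le_1: "no_meet E n x y \<le> 1"
proof (induction n arbitrary: x y)
  case (Suc n)
  have "avg2 E (no_meet E n) x y \<le> avg2 E (\<lambda>x y. 1) x y"
    by (intro avg2_mono Suc.IH)
  then show ?case by (simp add: avg2_const)
qed simp

lemma no_meet_Suc_le: "no_meet E (Suc n) x y \<le> no_meet E n x y"
proof (induction n arbitrary: x y)
  case 0
  show ?case using no_meet_le_1[of "Suc 0"] by simp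
next
  case (Suc n)
  then show ?case by (auto intro!: avg2_mono simp del: no_meet.simps simp: no_meet.simps(2)[of _ n] no_meet.simps(2)[of _ "Suc n"])
qed

lemma convergent_no_meet: "convergent (\<lambda>n. no_meet E n x y)"
proof -
  have "decseq (\<lambda>n. no_meet E n x y)"
    by (intro decseq_SucI no_meet_Suc_le)
  then obtain L where "(\<lambda>n. no_meet E n x y) \<longlonglongrightarrow> L"
    by (rule decseq_convergent[where B = 0]) (auto intro: no_meet_nonneg)
  then show ?thesis by (rule convergentI)
qed

definition never_meet :: "'a \<Rightarrow> 'a \<Rightarrow> real" where
  "never_meet x y = lim (\<lambda>n. no_meet E n x y)"

lemma no_meet_tendsto: "(\<lambda>n. no_meet E n x y) \<longlonglongrightarrow> never_meet x y"
  unfolding never_meet_def using convergent_no_meet by (simp add: convergent_LIMSEQ_iff)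

lemma never_meet_nonneg: "0 \<le> never_meet x y"
  by (rule LIMSEQ_le_const[OF no_meet_tendsto]) (auto intro: no_meet_nonneg)

lemma never_meet_le_1: "never_meet x y \<le> 1"
  by (rule LIMSEQ_le_const2[OF no_meet_tendsto]) (auto intro: no_meet_le_1)

text \<open>The recursion passes to the limit because averages are finite sums; off the diagonal
  \<open>never_meet\<close> is harmonic for the product walk.\<close>

lemma never_meet_rec: "never_meet x y = (if x = y then 0 else avg2 E never_meet x y)"
proof -
  have "(\<lambda>n. no_meet E (Suc n) x y) \<longlonglongrightarrow> (if x = y then 0 else avg2 E never_meet x y)"
    by (auto intro!: tendsto_avg2 no_meet_tendsto)
  with LIMSEQ_Suc[OF no_meet_tendsto[of x y]] show ?thesis
    by (rule LIMSEQ_unique)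
qed

section \<open>Law of the pair of walks\<close>

lemma nn_integral_neighbours:
  assumes "\<And>z. 0 \<le> g z"
  shows "(\<integral>\<^sup>+z. ennreal (g z) \<partial>measure_pmf (pmf_of_set (neighbours E x))) =
    ennreal ((\<Sum>z\<in>neighbours E x. g z) / real (card (neighbours E x)))"
  using assms card_neighbours_pos[of x]
  by (simp add: nn_integral_pmf_of_set finite_neighbours neighbours_nonempty divide_ennreal
      sum_nonneg ennreal_of_nat_eq_real_of_nat)

text \<open>Fubini reduces this to two uses of the one-walk Markov property, first with the second
  path frozen, then with the first.\<close>

lemma nn_integral_pair_Suc:
  fixes f :: "'a \<Rightarrow> 'a \<Rightarrow> real" and I :: "(nat \<Rightarrow> 'a) \<Rightarrow> (nat \<Rightarrow> 'a) \<Rightarrow> ennreal"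
  assumes f: "\<And>x y. 0 \<le> f x y"
    and I: "(\<lambda>p. I (fst p) (snd p)) \<in> borel_measurable (paths \<Otimes>\<^sub>M paths)"
    and dep1: "\<And>y. depends_upto n (\<lambda>x. I x y)" and dep2: "\<And>x. depends_upto n (I x)"
  shows "(\<integral>\<^sup>+p. I (fst p) (snd p) * ennreal (f (fst p (Suc n)) (snd p (Suc n))) \<partial>(srw E v \<Otimes>\<^sub>M srw E v)) =
    (\<integral>\<^sup>+p. I (fst p) (snd p) * ennreal (avg2 E f (fst p n) (snd p n)) \<partial>(srw E v \<Otimes>\<^sub>M srw E v))"
proof -
  let ?S = "srw E v"
  interpret S: prob_space ?S by (rule prob_space_srw)
  interpret P: pair_sigma_finite ?S ?S ..
  have sets_P: "sets (?S \<Otimes>\<^sub>M ?S) = sets (paths \<Otimes>\<^sub>M paths)"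
    by (rule sets_pair_measure_cong[OF sets_srw sets_srw])
  note meas = measurable_cong_sets[OF sets_P refl] measurable_cong_sets[OF sets_srw refl]
  \<comment> \<open>Half of \<open>avg2\<close>: the first coordinate has been averaged, the second
    not yet.\<close>
  define m where "m g x y = (\<Sum>z\<in>neighbours E x. g z y) / real (card (neighbours E x))" for g :: "'a \<Rightarrow> 'a \<Rightarrow> real" and x y
  have m: "0 \<le> m f x y" for x y
    unfolding m_def by (intro divide_nonneg_nonneg sum_nonneg f) auto
  have cm: "(\<lambda>p. I (fst p) (snd p) * ennreal (g (fst p i) (snd p j))) \<in> borel_measurable (?S \<Otimes>\<^sub>M ?S)" for g i j
    unfolding meas by (intro borel_measurable_times_ennreal I measurable_pair_path) auto
  have I1: "(\<lambda>x. I x y) \<in> borel_measurable paths" for y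
    using measurable_compose[OF measurable_Pair2'[of y paths paths] I] by (simp add: space_PiM)
  have I2: "I x \<in> borel_measurable paths" for x
    using measurable_compose[OF measurable_Pair1'[of x paths paths] I] by (simp add: space_PiM)
  have "(\<integral>\<^sup>+p. I (fst p) (snd p) * ennreal (f (fst p (Suc n)) (snd p (Suc n))) \<partial>(?S \<Otimes>\<^sub>M ?S)) =
     (\<integral>\<^sup>+y. \<integral>\<^sup>+x. I x y * ennreal (f (x (Suc n)) (y (Suc n))) \<partial>?S \<partial>?S)"
    using P.nn_integral_snd[OF cm[of f "Suc n" "Suc n"]] by simp
  also have "\<dots> = (\<integral>\<^sup>+y. \<integral>\<^sup>+x. I x y * ennreal (m f (x n) (y (Suc n))) \<partial>?S \<partial>?S)"
  proof (rule nn_integral_cong)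
    fix y
    show "(\<integral>\<^sup>+x. I x y * ennreal (f (x (Suc n)) (y (Suc n))) \<partial>?S) =
        (\<integral>\<^sup>+x. I x y * ennreal (m f (x n) (y (Suc n))) \<partial>?S)"
      using nn_integral_srw_Suc[OF I1 dep1, where f = "\<lambda>z. ennreal (f z (y (Suc n)))"]
      by (simp add: nn_integral_neighbours f m_def)
  qed
  also have "\<dots> = (\<integral>\<^sup>+x. \<integral>\<^sup>+y. I x y * ennreal (m f (x n) (y (Suc n))) \<partial>?S \<partial>?S)"
    using P.nn_integral_snd[OF cm[of "m f" n "Suc n"]] S.nn_integral_fst[OF cm[of "m f" n "Suc n"]] by simp
  also have "\<dots> = (\<integral>\<^sup>+x. \<integral>\<^sup>+y. I x y * ennreal (avg2 E f (x n) (y n)) \<partial>?S \<partial>?S)"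
  proof (rule nn_integral_cong)
    fix x
    have "(\<Sum>z\<in>neighbours E y. m f (x n) z) / real (card (neighbours E y)) = avg2 E f (x n) y" for y
      unfolding m_def avg2_def sum_divide_distrib[symmetric]
      by (subst sum.swap) (simp add: field_simps)
    then show "(\<integral>\<^sup>+y. I x y * ennreal (m f (x n) (y (Suc n))) \<partial>?S) =
        (\<integral>\<^sup>+y. I x y * ennreal (avg2 E f (x n) (y n)) \<partial>?S)"
      using nn_integral_srw_Suc[OF I2 dep2, where f = "\<lambda>z. ennreal (m f (x n) z)"]
      by (simp add: nn_integral_neighbours m)
  qed
  also have "\<dots> = (\<integral>\<^sup>+p. I (fst p) (snd p) * ennreal (avg2 E f (fst p n) (snd p n)) \<partial>(?S \<Otimes>\<^sub>M ?S))"
    using S.nn_integral_fst[OF cm[of "avg2 E f" n n]] by simp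
  finally show ?thesis .
qed

text \<open>Iterates the one-step identity with trivial \<open>I\<close>; at time \<open>0\<close>
  both walks sit at \<open>v\<close> almost surely.\<close>

lemma nn_integral_pair_iterate:
  assumes f: "\<And>x y. 0 \<le> f x y"
  shows "(\<integral>\<^sup>+p. ennreal (f (fst p n) (snd p n)) \<partial>(srw E v \<Otimes>\<^sub>M srw E v)) = ennreal ((avg2 E ^^ n) f v v)"
  using f
proof (induction n arbitrary: f)
  case 0
  let ?S = "srw E v"
  interpret S: prob_space ?S by (rule prob_space_srw)
  interpret P: pair_prob_space ?S ?S ..
  have "{x. x 0 = v} \<in> S.events"
    unfolding sets_srw
    using measurable_sets[OF measurable_component_singleton[of 0 UNIV "\<lambda>_::nat. count_space (UNIV::'a set)"], of "{v}"]
    by (simp add: space_PiM vimage_def)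
  moreover have "emeasure ?S {x. x 0 = v} = 1"
    using emeasure_srw_path[of E v 0 "\<lambda>_. v"] by simp
  moreover have "space ?S = UNIV"
    using sets_eq_imp_space_eq[OF sets_srw[of E v]] by (simp add: space_PiM)
  ultimately have AE: "AE x in ?S. x 0 = v"
    by (intro S.AE_I_eq_1) auto
  have "AE p in ?S \<Otimes>\<^sub>M ?S. fst p 0 = v \<and> snd p 0 = v"
  proof (rule P.AE_pair_measure)
    have "Measurable.pred (paths \<Otimes>\<^sub>M paths) (\<lambda>p. fst p 0 = v \<and> snd p 0 = v)"
      by (rule measurable_pair_path[where f = "\<lambda>x y. x = v \<and> y = v"]) auto
    then show "{p \<in> space (?S \<Otimes>\<^sub>M ?S). fst p 0 = v \<and> snd p 0 = v} \<in> sets (?S \<Otimes>\<^sub>M ?S)"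
      by (simp only: pred_def sets_pair_measure_cong[OF sets_srw sets_srw]
          sets_eq_imp_space_eq[OF sets_pair_measure_cong[OF sets_srw sets_srw]])
    show "AE x in ?S. AE y in ?S. fst (x, y) 0 = v \<and> snd (x, y) 0 = v"
      using AE by eventually_elim (use AE in eventually_elim, simp)
  qed
  then have "(\<integral>\<^sup>+p. ennreal (f (fst p 0) (snd p 0)) \<partial>(?S \<Otimes>\<^sub>M ?S)) = (\<integral>\<^sup>+p. ennreal (f v v) \<partial>(?S \<Otimes>\<^sub>M ?S))"
    by (intro nn_integral_cong_AE) auto
  then show ?case by (simp add: P.emeasure_space_1)
next
  case (Suc n)
  have "(\<integral>\<^sup>+p. ennreal (f (fst p (Suc n)) (snd p (Suc n))) \<partial>(srw E v \<Otimes>\<^sub>M srw E v)) =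
      (\<integral>\<^sup>+p. ennreal (avg2 E f (fst p n) (snd p n)) \<partial>(srw E v \<Otimes>\<^sub>M srw E v))"
    using nn_integral_pair_Suc[of f "\<lambda>_ _. 1" n v] Suc.prems by (simp add: depends_upto_def)
  also have "\<dots> = ennreal ((avg2 E ^^ n) (avg2 E f) v v)"
    using Suc.prems by (intro Suc.IH avg2_nonneg)
  finally show ?case by (simp add: funpow_swap1)
qed

lemma sets_no_meeting: "{p. \<forall>i\<in>{k..<n}. fst p i \<noteq> snd p i} \<in> sets (paths \<Otimes>\<^sub>M paths)"
proof -
  have "{p \<in> space (paths \<Otimes>\<^sub>M paths). \<forall>i\<in>{k..<n}. fst p i \<noteq> snd p i} \<in> sets (paths \<Otimes>\<^sub>M paths)"
    by (intro sets.sets_Collect_finite_All' predE measurable_pair_path) auto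
  then show ?thesis by (simp add: space_pair_measure space_PiM)
qed

text \<open>The Markov property moves the constraints one by one, latest first, from the event into
  \<open>no_meet\<close>; the \<open>k\<close> unconstrained steps before them become plain
  averages.\<close>

lemma emeasure_no_meeting:
  "emeasure (srw E v \<Otimes>\<^sub>M srw E v) {p. \<forall>i\<in>{k..<k + m}. fst p i \<noteq> snd p i} = ennreal ((avg2 E ^^ k) (no_meet E m) v v)"
proof -
  let ?S = "srw E v \<Otimes>\<^sub>M srw E v"
  have sets_P: "sets ?S = sets (paths \<Otimes>\<^sub>M paths)"
    by (rule sets_pair_measure_cong[OF sets_srw sets_srw])
  define N where "N n = {p :: (nat \<Rightarrow> 'a) \<times> (nat \<Rightarrow> 'a). \<forall>i\<in>{k..<n}. fst p i \<noteq> snd p i}" for n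
  have N: "N n \<in> sets (paths \<Otimes>\<^sub>M paths)" for n
    unfolding N_def by (rule sets_no_meeting)
  have "(\<integral>\<^sup>+p. indicator (N (k + m)) p * ennreal (no_meet E l (fst p (k + m)) (snd p (k + m))) \<partial>?S) =
     (\<integral>\<^sup>+p. ennreal (no_meet E (l + m) (fst p k) (snd p k)) \<partial>?S)" for l
  proof (induction m arbitrary: l)
    case 0
    show ?case by (simp add: N_def)
  next
    case (Suc m)
    define I :: "(nat \<Rightarrow> 'a) \<Rightarrow> (nat \<Rightarrow> 'a) \<Rightarrow> ennreal" where "I x y = indicator (N (Suc (k + m))) (x, y)" for x y
    have I: "(\<lambda>p. I (fst p) (snd p)) \<in> borel_measurable (paths \<Otimes>\<^sub>M paths)"
      unfolding I_def using N by simp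
    have dep: "depends_upto (k + m) (\<lambda>x. I x y)" "depends_upto (k + m) (I x)" for x y
      by (auto simp: depends_upto_def I_def N_def indicator_def less_Suc_eq_le)
    have "(\<integral>\<^sup>+p. indicator (N (k + Suc m)) p * ennreal (no_meet E l (fst p (k + Suc m)) (snd p (k + Suc m))) \<partial>?S) =
      (\<integral>\<^sup>+p. indicator (N (Suc (k + m))) p * ennreal (avg2 E (no_meet E l) (fst p (k + m)) (snd p (k + m))) \<partial>?S)"
      using nn_integral_pair_Suc[where f = "no_meet E l" and v = v, OF no_meet_nonneg I dep] by (simp add: I_def)
    also have "\<dots> = (\<integral>\<^sup>+p. indicator (N (k + m)) p * ennreal (no_meet E (Suc l) (fst p (k + m)) (snd p (k + m))) \<partial>?S)"
      by (intro nn_integral_cong) (auto simp: N_def indicator_def atLeastLessThanSuc)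
    also have "\<dots> = (\<integral>\<^sup>+p. ennreal (no_meet E (Suc l + m) (fst p k) (snd p k)) \<partial>?S)"
      by (rule Suc.IH)
    finally show ?case by simp
  qed
  from this[of 0] have "emeasure ?S (N (k + m)) = (\<integral>\<^sup>+p. ennreal (no_meet E m (fst p k) (snd p k)) \<partial>?S)"
    using N sets_P by simp
  also have "\<dots> = ennreal ((avg2 E ^^ k) (no_meet E m) v v)"
    by (rule nn_integral_pair_iterate[OF no_meet_nonneg])
  finally show ?thesis by (simp add: N_def)
qed

lemma AE_infinite_meetings:
  fixes c :: "'a \<Rightarrow> nat"
  assumes parity: "\<And>x y. y \<in> neighbours E x \<Longrightarrow> odd (c x + c y)"
    and never: "\<And>x y. even (c x + c y) \<Longrightarrow> never_meet x y = 0"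
  shows "AE (x, x') in srw E v \<Otimes>\<^sub>M srw E v. infinite {n. x n = x' n}"
proof -
  let ?S = "srw E v \<Otimes>\<^sub>M srw E v"
  define N where "N k n = {p :: (nat \<Rightarrow> 'a) \<times> (nat \<Rightarrow> 'a). \<forall>i\<in>{k..<n}. fst p i \<noteq> snd p i}" for k n
  have N: "N k n \<in> sets ?S" for k n
    unfolding N_def sets_pair_measure_cong[OF sets_srw sets_srw] by (rule sets_no_meeting)
  have lim: "(\<lambda>m. (avg2 E ^^ k) (no_meet E m) x y) \<longlonglongrightarrow> 0" if "even (c x + c y)" for k x y
    using that
  proof (induction k arbitrary: x y)
    case 0
    with no_meet_tendsto[of x y] never[of x y] show ?case by simp
  next
    case (Suc k)
    have "(\<lambda>m. avg2 E ((avg2 E ^^ k) (no_meet E m)) x y) \<longlonglongrightarrow> avg2 E (\<lambda>x y. 0) x y"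
    proof (rule tendsto_avg2)
      fix x' y' assume "x' \<in> neighbours E x" "y' \<in> neighbours E y"
      with Suc.prems parity[of x' x] parity[of y' y] show "(\<lambda>m. (avg2 E ^^ k) (no_meet E m) x' y') \<longlonglongrightarrow> 0"
        by (intro Suc.IH) auto
    qed
    then show ?case by (simp add: avg2_const)
  qed
  have null: "AE p in ?S. p \<notin> (\<Inter>m. N k (k + m))" for k
  proof (rule AE_not_in)
    have "emeasure ?S (\<Inter>m. N k (k + m)) \<le> ennreal ((avg2 E ^^ k) (no_meet E m) v v)" for m
      unfolding emeasure_no_meeting[symmetric]
      by (rule emeasure_mono) (use N[of k "k + m"] in \<open>auto simp: N_def\<close>)
    moreover have "(\<lambda>m. ennreal ((avg2 E ^^ k) (no_meet E m) v v)) \<longlonglongrightarrow> ennreal 0"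
      by (intro tendsto_ennrealI lim) simp
    ultimately have "emeasure ?S (\<Inter>m. N k (k + m)) \<le> ennreal 0"
      by (intro LIMSEQ_le_const) auto
    then show "(\<Inter>m. N k (k + m)) \<in> null_sets ?S"
      using N by (auto simp: null_sets_def)
  qed
  have "AE p in ?S. \<forall>k. p \<notin> (\<Inter>m. N k (k + m))"
    unfolding AE_all_countable using null by blast
  then show ?thesis
  proof eventually_elim
    case (elim p)
    have "\<exists>i\<ge>k. fst p i = snd p i" for k
      using elim by (fastforce simp: N_def)
    then show ?case
      by (auto simp: infinite_nat_iff_unbounded_le split: prod.splits)
  qed
qed

lemma never_meet_eq_0I:
  assumes parity: "\<And>x y. y \<in> neighbours E x \<Longrightarrow> odd (c x + c y)"
    and s: "s < 1" "\<And>x y. even (c x + c y) \<Longrightarrow> never_meet x y \<le> s"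
    and xy: "even (c x + c y)"
  shows "never_meet x y = (0::real)"
proof -
  have "never_meet x y \<le> s * no_meet E n x y" if "even (c x + c y)" for n x y
    using that
  proof (induction n arbitrary: x y)
    case 0
    then show ?case using s(2) by simp
  next
    case (Suc n)
    have "avg2 E never_meet x y \<le> avg2 E (\<lambda>x y. s * no_meet E n x y) x y"
    proof (rule avg2_mono)
      fix x' y' assume "x' \<in> neighbours E x" "y' \<in> neighbours E y"
      with Suc.prems parity[of x' x] parity[of y' y] show "never_meet x' y' \<le> s * no_meet E n x' y'"
        by (intro Suc.IH) auto
    qed
    then show ?case by (subst never_meet_rec) (simp add: avg2_cmult)
  qed
  with xy have "never_meet x y \<le> s * never_meet x y"
    by (intro LIMSEQ_le_const[OF tendsto_mult_left[OF no_meet_tendsto]]) auto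
  then have "(1 - s) * never_meet x y \<le> 0" by (simp add: algebra_simps)
  with s(1) have "never_meet x y \<le> 0" by (simp add: mult_le_0_iff)
  with never_meet_nonneg[of x y] show ?thesis by simp
qed

text \<open>
  Maximum principle for the product walk stopped on the diagonal or on leaving \<open>B\<close>.
\<close>

lemma potential_le_meeting_probability:
  fixes F :: "'a \<Rightarrow> 'a \<Rightarrow> real" and c :: "'a \<Rightarrow> nat"
  assumes parity: "\<And>x y. y \<in> neighbours E x \<Longrightarrow> odd (c x + c y)"
    and conn: "\<And>x y. (x, y) \<in> {(x, y). {x, y} \<in> E}\<^sup>*"
    and B: "finite B" "b \<notin> B" and K: "0 \<le> K"
    and harm: "\<And>x y. x \<in> B \<Longrightarrow> y \<in> B \<Longrightarrow> x \<noteq> y \<Longrightarrow> even (c x + c y) \<Longrightarrow> F x y \<le> avg2 E F x y"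
    and bdry: "\<And>x y. x \<notin> B \<or> y \<notin> B \<Longrightarrow> F x y \<le> 0"
    and diag: "\<And>x. x \<in> B \<Longrightarrow> F x x \<le> K"
    and xy: "even (c x + c y)"
  shows "F x y \<le> K * (1 - never_meet x y)"
proof (rule ccontr)
  define \<Phi> where "\<Phi> x y = F x y - K * (1 - never_meet x y)" for x y
  define P where "P = {p \<in> B \<times> B. even (c (fst p) + c (snd p))}"
  have \<Phi>_le_F: "\<Phi> x y \<le> F x y" for x y
    using K never_meet_le_1[of x y] by (simp add: \<Phi>_def)
  assume "\<not> F x y \<le> K * (1 - never_meet x y)"
  then have pos: "0 < \<Phi> x y" by (simp add: \<Phi>_def)
  with \<Phi>_le_F[of x y] bdry[of x y] xy have P: "(x, y) \<in> P" by (force simp: P_def)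
  have finP: "finite P" using B(1) by (simp add: P_def)
  define \<mu> where "\<mu> = Max ((\<lambda>p. \<Phi> (fst p) (snd p)) ` P)"
  have le_\<mu>: "\<Phi> u z \<le> \<mu>" if "(u, z) \<in> P" for u z
    unfolding \<mu>_def using finP imageI[OF that, of "\<lambda>p. \<Phi> (fst p) (snd p)"] by (intro Max_ge) auto
  have \<mu>: "0 < \<mu>" using le_\<mu>[OF P] pos by linarith
  have "\<mu> \<in> (\<lambda>p. \<Phi> (fst p) (snd p)) ` P"
    unfolding \<mu>_def using finP P by (intro Max_in) auto
  then obtain x0 y0 where 0: "(x0, y0) \<in> P" "\<Phi> x0 y0 = \<mu>" by auto
  have max_step: "(u', z') \<in> P \<and> \<Phi> u' z' = \<mu>"
    if uz: "(u, z) \<in> P" "\<Phi> u z = \<mu>" and nb: "u' \<in> neighbours E u" "z' \<in> neighbours E z" for u z u' z'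
  proof -
    have in_B: "u \<in> B" "z \<in> B" and ev: "even (c u + c z)" using uz(1) by (auto simp: P_def)
    have "u \<noteq> z"
    proof
      assume "u = z"
      then have "\<Phi> u z \<le> 0" using diag[OF in_B(1)] never_meet_rec[of u u] by (simp add: \<Phi>_def)
      with \<mu> uz(2) show False by simp
    qed
    have le: "\<Phi> v w \<le> \<mu>" if "v \<in> neighbours E u" "w \<in> neighbours E z" for v w
    proof (cases "v \<in> B \<and> w \<in> B")
      case True
      with ev parity[OF that(1)] parity[OF that(2)] show ?thesis by (intro le_\<mu>) (auto simp: P_def)
    next
      case False
      with \<Phi>_le_F[of v w] bdry[of v w] \<mu> show ?thesis by force
    qed
    have "\<mu> \<le> avg2 E \<Phi> u z"
    proof -
      have "avg2 E \<Phi> u z = avg2 E F u z - K * (1 - avg2 E never_meet u z)"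
        unfolding \<Phi>_def by (simp add: avg2_diff avg2_cmult avg2_const)
      also have "avg2 E never_meet u z = never_meet u z"
        using \<open>u \<noteq> z\<close> never_meet_rec[of u z] by simp
      finally have "avg2 E \<Phi> u z = avg2 E F u z - K * (1 - never_meet u z)" .
      moreover have "\<mu> = F u z - K * (1 - never_meet u z)"
        using uz(2) by (simp add: \<Phi>_def)
      ultimately show ?thesis
        using harm[OF in_B \<open>u \<noteq> z\<close> ev] by linarith
    qed
    then have "avg2 E (\<lambda>v w. \<mu> - \<Phi> v w) u z \<le> 0"
      by (simp add: avg2_diff avg2_const)
    then have "(\<Sum>v\<in>neighbours E u. \<Sum>w\<in>neighbours E z. \<mu> - \<Phi> v w) \<le> 0"
      using mult_pos_pos[of "real (card (neighbours E u))" "real (card (neighbours E z))"]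
        card_neighbours_pos[of u] card_neighbours_pos[of z]
      by (simp add: avg2_def pos_divide_le_eq)
    moreover have "0 \<le> (\<Sum>v\<in>neighbours E u. \<Sum>w\<in>neighbours E z. \<mu> - \<Phi> v w)"
      by (intro sum_nonneg) (simp add: le)
    ultimately have "(\<Sum>v\<in>neighbours E u. \<Sum>w\<in>neighbours E z. \<mu> - \<Phi> v w) = 0"
      by simp
    then have "\<forall>v\<in>neighbours E u. (\<Sum>w\<in>neighbours E z. \<mu> - \<Phi> v w) = 0"
      by (subst (asm) sum_nonneg_eq_0_iff) (auto intro!: sum_nonneg simp: finite_neighbours le)
    with nb(1) have "(\<Sum>w\<in>neighbours E z. \<mu> - \<Phi> u' w) = 0" by blast
    then have "\<forall>w\<in>neighbours E z. \<mu> - \<Phi> u' w = 0"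
      by (subst (asm) sum_nonneg_eq_0_iff) (auto simp: finite_neighbours le nb(1))
    with nb(2) have eq: "\<Phi> u' z' = \<mu>" by auto
    with \<mu> \<Phi>_le_F[of u' z'] bdry[of u' z'] have "u' \<in> B" "z' \<in> B" by force+
    with ev parity[OF nb(1)] parity[OF nb(2)] eq show ?thesis by (auto simp: P_def)
  qed
  have "\<exists>z. (u, z) \<in> P \<and> \<Phi> u z = \<mu>" if "(x0, u) \<in> {(x, y). {x, y} \<in> E}\<^sup>*" for u
    using that
  proof (induction rule: rtrancl_induct)
    case base
    then show ?case using 0 by blast
  next
    case (step u u')
    then obtain z where "(u, z) \<in> P" "\<Phi> u z = \<mu>" by blast
    moreover from step have "u' \<in> neighbours E u" by (simp add: neighbours_def)
    moreover obtain z' where "z' \<in> neighbours E z" using neighbours_nonempty[of z] by blast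
    ultimately show ?case using max_step by blast
  qed
  from this[OF conn, of b] B(2) show False by (auto simp: P_def)
qed

end

section \<open>Distances and Green functions on trees\<close>

locale parent_tree =
  fixes par :: "nat \<Rightarrow> nat"
  assumes par_less: "0 < n \<Longrightarrow> par n < n"
    and finite_children: "finite {y. 0 < y \<and> par y = x}"
begin

definition edges :: "nat set set" where
  "edges = {{n, par n} | n. 0 < n}"

function depth :: "nat \<Rightarrow> nat" where
  "depth n = (if n = 0 then 0 else Suc (depth (par n)))"
  by auto
termination by (relation "Wellfounded.measure id") (auto simp: par_less)

function tdist :: "nat \<Rightarrow> nat \<Rightarrow> nat" where
  "tdist x y = (if x = y then 0 else if x < y then Suc (tdist x (par y)) else Suc (tdist (par x) y))"
  by auto
termination by (relation "Wellfounded.measure (\<lambda>(x, y). x + y)") (auto simp: par_less)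

declare depth.simps [simp del] tdist.simps [simp del]

lemma depth_0 [simp]: "depth 0 = 0"
  by (simp add: depth.simps)

lemma depth_par: "0 < n \<Longrightarrow> depth n = Suc (depth (par n))"
  by (subst depth.simps) simp

lemma tdist_refl [simp]: "tdist x x = 0"
  by (simp add: tdist.simps)

lemma tdist_less: "x < y \<Longrightarrow> tdist x y = Suc (tdist x (par y))"
  by (subst tdist.simps) simp

lemma tdist_greater: "y < x \<Longrightarrow> tdist x y = Suc (tdist (par x) y)"
  by (subst tdist.simps) simp

lemma tdist_commute: "tdist x y = tdist y x"
proof (induction x y rule: tdist.induct)
  case (1 x y)
  then show ?case
    by (cases x y rule: linorder_cases) (simp_all add: tdist_less tdist_greater)
qed

lemma tdist_pos: "x \<noteq> y \<Longrightarrow> 0 < tdist x y"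
  by (cases x y rule: linorder_cases) (simp_all add: tdist_less tdist_greater)

lemma tdist_le_depth: "tdist x y \<le> depth x + depth y"
proof (induction x y rule: tdist.induct)
  case (1 x y)
  then show ?case
    by (cases x y rule: linorder_cases) (simp_all add: tdist_less tdist_greater depth_par)
qed

lemma depth_le_tdist: "depth y \<le> depth x + tdist x y"
proof (induction x y rule: tdist.induct)
  case (1 x y)
  then show ?case
    by (cases x y rule: linorder_cases) (simp_all add: tdist_less tdist_greater depth_par)
qed

lemma mem_neighbours: "y \<in> neighbours edges x \<longleftrightarrow> (0 < y \<and> par y = x) \<or> (0 < x \<and> y = par x)"
  by (auto simp: neighbours_def edges_def doubleton_eq_iff)

lemma neighbours_edges:
  "neighbours edges x = {y. 0 < y \<and> par y = x} \<union> (if x = 0 then {} else {par x})"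
  by (auto simp: mem_neighbours)

lemma finite_neighbours_edges: "finite (neighbours edges x)"
  by (simp add: neighbours_edges finite_children)

lemma odd_depth_neighbours: "y \<in> neighbours edges x \<Longrightarrow> odd (depth x + depth y)"
  by (auto simp: mem_neighbours depth_par)

lemma connected_edges: "(x, y) \<in> {(x, y). {x, y} \<in> edges}\<^sup>*"
proof -
  let ?R = "{(x, y). {x, y} \<in> edges}"
  have 0: "(x, 0) \<in> ?R\<^sup>*" for x
  proof (induction x rule: less_induct)
    case (less x)
    show ?case
    proof (cases "x = 0")
      case False
      then have "(x, par x) \<in> ?R" by (auto simp: edges_def)
      with less[OF par_less[of x]] False show ?thesis by (auto intro: converse_rtrancl_into_rtrancl)
    qed simp
  qed
  have "sym ?R" by (auto simp: sym_def insert_commute)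
  then have "(0, y) \<in> ?R\<^sup>*" using 0[of y] by (metis sym_rtrancl symD)
  with 0[of x] show ?thesis by (rule rtrancl_trans)
qed

text \<open>
  Among the neighbours of \<open>x \<noteq> y\<close> exactly one is closer to \<open>y\<close>, all others are further away.
\<close>

lemma sum_tdist_neighbours:
  assumes "x \<noteq> y"
  shows "(\<Sum>z\<in>neighbours edges x. real (tdist z y)) =
    real (card (neighbours edges x)) * (real (tdist x y) + 1) - 2"
  using assms
proof (induction y rule: less_induct)
  case (less y)
  let ?N = "neighbours edges x" and ?C = "{z. 0 < z \<and> par z = x}"
  show ?case
  proof (cases "y < x")
    case True
    have N: "?N = insert (par x) ?C" using True by (auto simp: neighbours_edges)
    have "par x \<notin> ?C" using par_less[of x] par_less[of "par x"] True by auto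
    moreover have "tdist z y = Suc (tdist x y)" if "z \<in> ?C" for z
      using that par_less[of z] True by (auto simp: tdist_greater[of y z])
    moreover have "tdist x y = Suc (tdist (par x) y)" using True by (rule tdist_greater)
    ultimately show ?thesis
      by (simp add: N finite_children algebra_simps)
  next
    case False
    with less.prems have xy: "x < y" by simp
    show ?thesis
    proof (cases "par y = x")
      case True
      have y: "y \<in> ?N" using True xy by (simp add: mem_neighbours)
      have "tdist z y = 2" if "z \<in> ?N - {y}" for z
      proof -
        have "tdist z x = 1"
          using that par_less[of z] par_less[of x]
          by (auto simp: mem_neighbours tdist_greater tdist_less)
        moreover have "tdist z y = Suc (tdist z x)"
        proof (cases "z < y")
          case True
          then show ?thesis using \<open>par y = x\<close> by (simp add: tdist_less)
        next
          case False
          with that xy par_less[of x] have "y < z" "par z = x" by (auto simp: mem_neighbours)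
          then show ?thesis using xy \<open>par y = x\<close> \<open>tdist z x = 1\<close> by (simp add: tdist_greater tdist_less)
        qed
        ultimately show ?thesis by simp
      qed
      then have "(\<Sum>z\<in>?N. real (tdist z y)) = 2 * real (card (?N - {y}))"
        by (subst sum.remove[OF finite_neighbours_edges y]) simp
      also have "card (?N - {y}) = card ?N - 1"
        using y by simp
      also have "real (card ?N - 1) = real (card ?N) - 1"
        using y finite_neighbours_edges[of x] by (subst of_nat_diff) (auto simp: Suc_le_eq card_gt_0_iff)
      finally show ?thesis using True xy by (simp add: tdist_less)
    next
      case False
      have "tdist z y = Suc (tdist z (par y))" if z: "z \<in> ?N" for z
      proof (cases "z < y")
        case True
        then show ?thesis by (rule tdist_less)
      next
        case False
        from z \<open>par y \<noteq> x\<close> xy have "z \<noteq> y" using par_less[of x] by (auto simp: mem_neighbours)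
        with z False xy have z': "y < z" "par z = x" using par_less[of x] by (auto simp: mem_neighbours)
        have "par y < z" using par_less[of y] xy z'(1) by simp
        then show ?thesis using z' xy by (simp add: tdist_greater tdist_less)
      qed
      moreover have "(\<Sum>z\<in>?N. real (tdist z (par y))) = real (card ?N) * (real (tdist x (par y)) + 1) - 2"
        using xy par_less[of y] False by (intro less.IH) auto
      ultimately show ?thesis
        using xy by (simp add: sum.distrib tdist_less algebra_simps)
    qed
  qed
qed

text \<open>
  The Green function of the simple random walk killed at \<open>a\<close> and \<open>b\<close>, divided by the degree.
  Killed at \<open>a\<close> only, it is the Gromov product \<open>(x|y)\<^sub>a\<close>.
\<close>

definition green1 :: "nat \<Rightarrow> nat \<Rightarrow> nat \<Rightarrow> real" where
  "green1 a x y = (real (tdist x a) + real (tdist y a) - real (tdist x y)) / 2"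

definition green2 :: "nat \<Rightarrow> nat \<Rightarrow> nat \<Rightarrow> nat \<Rightarrow> real" where
  "green2 a b x y = green1 a x y - green1 a x b * green1 a y b / real (tdist a b)"

lemma green1_commute: "green1 a x y = green1 a y x"
  by (simp add: green1_def tdist_commute)

lemma green2_commute: "green2 a b x y = green2 a b y x"
  by (simp add: green2_def green1_commute mult.commute)

lemma green2_boundary: "x = a \<or> x = b \<Longrightarrow> a \<noteq> b \<Longrightarrow> green2 a b x y = 0"
  using tdist_pos[of a b] tdist_commute[of a y] tdist_commute[of b y] tdist_commute[of b a]
  by (auto simp: green2_def green1_def)

lemma sum_green1_neighbours:
  assumes "x \<noteq> a" "x \<noteq> y"
  shows "(\<Sum>z\<in>neighbours edges x. green1 a z y) = real (card (neighbours edges x)) * green1 a x y"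
  unfolding green1_def sum_divide_distrib[symmetric]
  by (simp add: sum.distrib sum_subtractf sum_tdist_neighbours assms algebra_simps)

lemma sum_green2_neighbours:
  assumes "x \<noteq> a" "x \<noteq> b" "x \<noteq> y"
  shows "(\<Sum>z\<in>neighbours edges x. green2 a b z y) = real (card (neighbours edges x)) * green2 a b x y"
  unfolding green2_def
  by (simp add: sum_subtractf sum_green1_neighbours assms algebra_simps
      flip: sum_divide_distrib sum_distrib_right sum_distrib_left)

lemma avg2_green2:
  assumes x: "x \<noteq> a" "x \<noteq> b" and y: "y \<noteq> a" "y \<noteq> b" and "x \<noteq> y" "even (depth x + depth y)"
    and ne: "neighbours edges x \<noteq> {}" "neighbours edges y \<noteq> {}"
  shows "avg2 edges (green2 a b) x y = green2 a b x y"
proof -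
  let ?n = "\<lambda>x. real (card (neighbours edges x))"
  have "(\<Sum>x'\<in>neighbours edges x. \<Sum>y'\<in>neighbours edges y. green2 a b x' y') =
      (\<Sum>y'\<in>neighbours edges y. \<Sum>x'\<in>neighbours edges x. green2 a b x' y')"
    by (rule sum.swap)
  also have "\<dots> = (\<Sum>y'\<in>neighbours edges y. ?n x * green2 a b y' x)"
  proof (rule sum.cong)
    fix y' assume "y' \<in> neighbours edges y"
    with odd_depth_neighbours[of y' y] assms(6) have "x \<noteq> y'" by (auto simp: add.commute)
    then show "(\<Sum>x'\<in>neighbours edges x. green2 a b x' y') = ?n x * green2 a b y' x"
      by (simp add: sum_green2_neighbours x green2_commute[of a b y'])
  qed simp
  also have "\<dots> = ?n x * (?n y * green2 a b x y)"
    using \<open>x \<noteq> y\<close> by (simp add: sum_green2_neighbours y green2_commute[of a b x] flip: sum_distrib_left)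
  finally show ?thesis
    using ne by (simp add: avg2_def finite_neighbours_edges)
qed

end

section \<open>Trees attached to the last two vertices\<close>

locale last_two_tree =
  fixes par :: "nat \<Rightarrow> nat"
  assumes par_1: "par (Suc 0) = 0"
    and par_Suc_Suc: "par (Suc (Suc n)) = Suc n \<or> par (Suc (Suc n)) = n"
begin

lemma par_bounds: "0 < n \<Longrightarrow> par n < n \<and> n \<le> par n + 2"
  using par_1 par_Suc_Suc[of "n - 2"] by (cases n rule: nat.exhaust; cases "n - 1") auto

sublocale parent_tree par
proof
  show "finite {y. 0 < y \<and> par y = x}" for x
    by (rule finite_subset[of _ "{..x + 2}"]) (use par_bounds in auto)
qed (simp add: par_bounds)

sublocale srw_graph edges
proof
  show "finite (neighbours edges x)" for x
    by (rule finite_neighbours_edges)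
  show "neighbours edges x \<noteq> {}" for x
    using par_1 by (cases "x = 0") (auto simp: neighbours_edges)
qed

lemma neighbour_le: "y \<in> neighbours edges x \<Longrightarrow> y \<le> x + 2"
  using par_bounds[of y] par_bounds[of x] by (auto simp: mem_neighbours)

lemma depth_Suc: "depth n \<le> depth (Suc n) \<and> depth (Suc n) \<le> Suc (depth n)"
proof (induction n)
  case 0
  then show ?case by (simp add: depth_par par_1)
next
  case (Suc n)
  then show ?case
    using par_Suc_Suc[of n] depth_par[of "Suc (Suc n)"] by auto
qed

lemma depth_mono: "m \<le> n \<Longrightarrow> depth m \<le> depth n"
  by (rule lift_Suc_mono_le[of depth, OF conjunct1[OF depth_Suc]])

lemma le_depth: "n \<le> depth (2 * n)"
proof (induction n)
  case (Suc n)
  then show ?case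
    using par_Suc_Suc[of "2 * n"] depth_par[of "Suc (Suc (2 * n))"] depth_Suc[of "2 * n"] by auto
qed simp

lemma green2_diag_le:
  assumes "x \<le> N"
  shows "green2 N (Suc N) x x \<le> 2 * real (depth N)"
proof -
  have "green2 N (Suc N) x x \<le> green1 N x x"
    by (simp add: green2_def)
  also have "\<dots> = real (tdist x N)"
    by (simp add: green1_def)
  also have "\<dots> \<le> 2 * real (depth N)"
    using tdist_le_depth[of x N] depth_mono[OF assms] by simp
  finally show ?thesis .
qed

lemma green2_ge:
  fixes x y :: nat
  defines "c \<equiv> real (depth x + depth y)"
  shows "real (depth N) / 2 - (2 * c + c\<^sup>2) \<le> green2 N (Suc N) x y"
proof -
  let ?a = N and ?b = "Suc N"
  define L where "L = real (tdist ?a ?b)"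
  define t where "t = (L + real (depth ?a) - real (depth ?b)) / 2"
  have L: "1 \<le> L" using tdist_pos[of ?a ?b] by (simp add: L_def)
  have t0: "0 \<le> t" using depth_le_tdist[of ?b ?a] by (simp add: t_def L_def)
  have tL: "2 * t \<le> L" using depth_Suc[of N] by (simp add: t_def)
  have tH: "t \<le> real (depth ?a)" using tdist_le_depth[of ?a ?b] by (simp add: t_def L_def)
  have c0: "0 \<le> c" by (simp add: c_def)
  have A: "\<bar>green1 ?a z ?b\<bar> \<le> t + c" if "z = x \<or> z = y" for z
  proof -
    have dz: "real (depth z) \<le> c" using that by (auto simp: c_def)
    have bound: "\<bar>real (tdist z v) - real (depth v)\<bar> \<le> real (depth z)" for v
      using tdist_le_depth[of z v] depth_le_tdist[of v z] by linarith
    have half: "\<lbrakk>\<bar>r\<bar> \<le> d; \<bar>s\<bar> \<le> d\<rbrakk> \<Longrightarrow> \<bar>(r - s) / 2\<bar> \<le> d" for r s d :: real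
      using abs_triangle_ineq4[of r s] by simp
    have "green1 ?a z ?b = t + ((real (tdist z ?a) - real (depth ?a)) - (real (tdist z ?b) - real (depth ?b))) / 2"
      unfolding green1_def t_def L_def tdist_commute[of ?b ?a]
      by (simp add: add_divide_distrib diff_divide_distrib)
    with half[OF bound[of ?a] bound[of ?b]] dz t0 show ?thesis by linarith
  qed
  have "green1 ?a x ?b * green1 ?a y ?b \<le> \<bar>green1 ?a x ?b\<bar> * \<bar>green1 ?a y ?b\<bar>"
    by (metis abs_ge_self abs_mult)
  also have "\<dots> \<le> (t + c) * (t + c)"
    using A t0 c0 by (intro mult_mono) auto
  also have "\<dots> = 2 * t * (t / 2) + 2 * t * c + 1 * c\<^sup>2"
    by (simp add: power2_eq_square algebra_simps)
  also have "\<dots> \<le> L * (t / 2) + L * c + L * c\<^sup>2"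
    using L t0 tL c0 by (intro add_mono mult_right_mono) auto
  also have "\<dots> = (t / 2 + c + c\<^sup>2) * L"
    by (simp add: algebra_simps)
  finally have "green1 ?a x ?b * green1 ?a y ?b / L \<le> t / 2 + c + c\<^sup>2"
    using L by (simp add: pos_divide_le_eq)
  moreover have "real (depth ?a) - c \<le> green1 ?a x y"
    using depth_le_tdist[of ?a x] depth_le_tdist[of ?a y] tdist_le_depth[of x y] tdist_commute[of x ?a]
      tdist_commute[of y ?a] by (simp add: green1_def c_def)
  ultimately show ?thesis
    using tH by (simp add: green2_def flip: L_def)
qed

lemma green2_le_meeting_probability:
  assumes "x < N" "y < N" "even (depth x + depth y)"
  shows "green2 N (Suc N) x y \<le> 2 * real (depth N) * (1 - never_meet x y)"
proof -
  define F where "F u v = (if u < N \<and> v < N then green2 N (Suc N) u v else 0)" for u v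
  have green2_eq_F: "green2 N (Suc N) u v = F u v" if "u < N + 2" "v < N + 2" for u v
  proof -
    have "u < N \<and> v < N \<or> u = N \<or> u = Suc N \<or> v = N \<or> v = Suc N"
      using that by auto
    then show ?thesis
      using green2_boundary[of u N "Suc N" v] green2_boundary[of v N "Suc N" u]
      by (auto simp: F_def green2_commute[of N "Suc N" u v])
  qed
  have "F x y \<le> 2 * real (depth N) * (1 - never_meet x y)"
  proof (rule potential_le_meeting_probability[where B = "{..<N}" and b = N and c = depth])
    fix u v assume uv: "u \<in> {..<N}" "v \<in> {..<N}" "u \<noteq> v" "even (depth u + depth v)"
    have "F u v = avg2 edges (green2 N (Suc N)) u v"
      using uv by (subst avg2_green2) (auto simp: F_def neighbours_nonempty)
    also have "\<dots> \<le> avg2 edges F u v"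
    proof (rule avg2_mono)
      fix u' v' assume "u' \<in> neighbours edges u" "v' \<in> neighbours edges v"
      then show "green2 N (Suc N) u' v' \<le> F u' v'"
        using neighbour_le[of u' u] neighbour_le[of v' v] uv(1,2) by (simp add: green2_eq_F)
    qed
    finally show "F u v \<le> avg2 edges F u v" .
  qed (use assms in \<open>auto simp: F_def green2_diag_le odd_depth_neighbours connected_edges simp del: even_add odd_add\<close>)
  with assms show ?thesis by (simp add: F_def)
qed

lemma never_meet_le: "never_meet x y \<le> 4 / 5" if "even (depth x + depth y)"
proof -
  define k where "k = depth x + depth y"
  define N where "N = 2 * (Suc (x + y) + 10 * (2 * k + k\<^sup>2))"
  define H where "H = real (depth N)"
  define e where "e = 2 * k + k\<^sup>2"
  have "Suc (x + y) + 10 * e \<le> depth N"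
    unfolding N_def e_def by (rule le_depth)
  then have H: "1 \<le> H" "10 * real e \<le> H"
    unfolding H_def by linarith+
  have "H / 2 - real e \<le> green2 N (Suc N) x y"
    using green2_ge[of N x y] by (simp add: H_def k_def e_def)
  also have "\<dots> \<le> 2 * H * (1 - never_meet x y)"
    unfolding H_def using that by (intro green2_le_meeting_probability) (auto simp: N_def)
  finally have "2 / 5 * H \<le> 2 * H * (1 - never_meet x y)"
    using H(2) by linarith
  then have "H * (2 / 5) \<le> H * (2 * (1 - never_meet x y))"
    by (simp add: algebra_simps)
  with H(1) have "2 / 5 \<le> 2 * (1 - never_meet x y)"
    by (subst (asm) mult_le_cancel_left_pos) auto
  then show ?thesis by simp
qed

lemma infinite_collision_property_edges: "infinite_collision_property UNIV edges"
  unfolding infinite_collision_property_def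
proof (intro conjI ballI)
  show "simple_graph UNIV edges"
    using par_bounds by (auto simp: simple_graph_def edges_def card_2_iff) (metis less_irrefl)
  show "connected_graph UNIV edges"
    by (simp add: connected_graph_def connected_edges)
  show "locally_finite_graph UNIV edges"
    by (simp add: locally_finite_graph_def finite_neighbours)
  show "AE (x, x') in srw edges v \<Otimes>\<^sub>M srw edges v. infinite {n. x n = x' n}" for v
  proof (rule AE_infinite_meetings[where c = depth])
    show "odd (depth x + depth y)" if "y \<in> neighbours edges x" for x y
      using that by (rule odd_depth_neighbours)
    show "never_meet x y = 0" if "even (depth x + depth y)" for x y
      by (rule never_meet_eq_0I[OF odd_depth_neighbours _ never_meet_le that]) auto
  qed
qed simp

end

lemma tree_vertices_eq: "tree_vertices = UNIV"
proof -
  have "x \<in> step_vertices (Suc x)" for x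
    by (simp add: step_vertices_def)
  then show ?thesis by (force simp: tree_vertices_def)
qed

lemma step_edges_eq:
  "step_edges w n = (\<lambda>k. {k, (if k \<le> 1 then 0 else w (k - 1))}) ` {1..n}"
proof (induction w n rule: step_edges.induct)
  case (3 w n)
  have "{1..Suc (Suc n)} = insert (Suc (Suc n)) {1..Suc n}"
    by (rule atLeastAtMostSuc_conv) simp
  then show ?case using 3 by simp
qed (auto simp: insert_commute)

lemma infinite_collision_property_tree:
  assumes "\<And>n. 1 \<le> n \<Longrightarrow> w n = n \<or> w n = n - 1"
  shows "infinite_collision_property tree_vertices (tree_edges w)"
proof -
  define par where "par k = (if k \<le> 1 then 0 else w (k - 1))" for k
  interpret last_two_tree par
    using assms[of "Suc _"] by unfold_locales (auto simp: par_def)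
  have "tree_edges w = edges"
  proof -
    have "(\<Union>n\<in>{1..}. {1..n}) = {0::nat<..}" by force
    then have "tree_edges w = (\<lambda>k. {k, par k}) ` {0<..}"
      unfolding tree_edges_def step_edges_eq par_def[symmetric] image_UN[symmetric] by simp
    then show ?thesis by (auto simp: edges_def)
  qed
  then show ?thesis
    using infinite_collision_property_edges by (simp add: tree_vertices_eq)
qed

theorem theorem1p2:
  fixes M :: "'b measure" and w :: "nat \<Rightarrow> 'b \<Rightarrow> nat" and p q :: real
  assumes "prob_space M"
    and "q = 1 - p"
    and "prob_space.indep_vars M (\<lambda>_. count_space UNIV) w {1..}"
    and "\<And>n. n \<ge> 1 \<Longrightarrow> measure M {\<omega> \<in> space M. w n \<omega> = n} = p"
    and "\<And>n. n \<ge> 1 \<Longrightarrow> measure M {\<omega> \<in> space M. w n \<omega> = n - 1} = q"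
  shows "AE \<omega> in M. infinite_collision_property tree_vertices (tree_edges (\<lambda>n. w n \<omega>))"
proof -
  interpret prob_space M by fact
  have "AE \<omega> in M. w n \<omega> = n \<or> w n \<omega> = n - 1" if n: "n \<ge> 1" for n
  proof -
    have "random_variable (count_space UNIV) (w n)"
      using assms(3) n by (simp add: indep_vars_def)
    then have ev: "{\<omega> \<in> space M. w n \<omega> = k} \<in> events" for k
      using measurable_sets[of "w n" M "count_space UNIV" "{k}"] by (simp add: vimage_def Int_def conj_commute)
    have "prob ({\<omega> \<in> space M. w n \<omega> = n} \<union> {\<omega> \<in> space M. w n \<omega> = n - 1}) = p + q"
      unfolding assms(4)[OF n, symmetric] assms(5)[OF n, symmetric]
      using n by (intro finite_measure_Union ev) auto
    then have "AE \<omega> in M. \<omega> \<in> {\<omega> \<in> space M. w n \<omega> = n} \<union> {\<omega> \<in> space M. w n \<omega> = n - 1}"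
      using ev assms(2) by (subst prob_eq_1[symmetric]) auto
    then show ?thesis by eventually_elim auto
  qed
  then have "AE \<omega> in M. \<forall>n. n \<ge> 1 \<longrightarrow> w n \<omega> = n \<or> w n \<omega> = n - 1"
    unfolding AE_all_countable by auto
  then show ?thesis
    by eventually_elim (rule infinite_collision_property_tree, blast)
qed

end
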